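(* Let $n\ge 2$ be an integer, let $0<a<n(n-1)^{(1-n)/n}$, and let $R(z)=\dfrac{a z^{n-1}}{z^n-1}$. Then $R$ is a rational Ahlfors function.
   Context: $\widehat{\mathbb{C}}$ is the Riemann sphere and $\mathbb{D}=\{z\in\mathbb{C}:|z|<1\}$ is the open unit disk. For a rational map $R$, $R^{-1}(\mathbb{D})=\{z\in\widehat{\mathbb{C}}:|R(z)|<1\}$. Ahlfors function: let $X\subset\widehat{\mathbb{C}}$ be a domain containing $\infty$. For holomorphic $f:X\to\mathbb{C}$, put $f'(\infty):=\lim_{z\to\infty}z(f(z)-f(\infty))$. The Ahlfors function on $X$ is the unique function maximizing $\mathrm{Re}\,f'(\infty)$ among all holomorphic $f:X\to\mathbb{D}$ with $f(\infty)=0$. A rational map $R$ of degree $n$ is called $n$-good if $R(\infty)=0$, $R^{-1}(\mathbb{D})$ is connected, and $R^{-1}(\widehat{\mathbb{C}}\setminus\mathbb{D})$ has exactly $n$ connected components. A rational Ahlfors function (of degree $n$) is an $n$-good rational map $R$ whose restriction to $R^{-1}(\mathbb{D})$ is the Ahlfors function on $R^{-1}(\mathbb{D})$. *)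

theory Defs
  imports "HOL-Analysis.Analysis" "HOL-Computational_Algebra.Polynomial"
begin

text \<open>
  The Riemann sphere is the one-point compactification of the complex plane: \<open>Some z\<close> is a finite
  point and \<open>None\<close> is the point at infinity.
\<close>

type_synonym riemann_sphere = "complex option"

definition sphere_top :: "riemann_sphere topology" where
  "sphere_top = Alexandroff_compactification euclidean"

definition unit_disk :: "riemann_sphere set" where
  "unit_disk = Some ` ball 0 1"

text \<open>Inverse of the standard chart \<open>z \<mapsto> 1/z\<close> around the point at infinity.\<close>

definition chart_inf :: "complex \<Rightarrow> riemann_sphere" where
  "chart_inf w = (if w = 0 then None else Some (1 / w))"

definition sphere_domain :: "riemann_sphere set \<Rightarrow> bool" where
  "sphere_domain X \<longleftrightarrow> openin sphere_top X \<and> connectedin sphere_top X \<and> X \<noteq> {}"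

text \<open>Holomorphy of a complex-valued function on an open subset of the sphere, in the two charts.\<close>

definition sphere_holomorphic_on :: "(riemann_sphere \<Rightarrow> complex) \<Rightarrow> riemann_sphere set \<Rightarrow> bool" where
  "sphere_holomorphic_on f X \<longleftrightarrow>
     (f \<circ> Some) holomorphic_on (Some -` X) \<and>
     (f \<circ> chart_inf) holomorphic_on (chart_inf -` X)"

definition deriv_inf :: "(riemann_sphere \<Rightarrow> complex) \<Rightarrow> complex" where
  "deriv_inf f = Lim at_infinity (\<lambda>z. z * (f (Some z) - f None))"

definition ahlfors_admissible :: "riemann_sphere set \<Rightarrow> (riemann_sphere \<Rightarrow> complex) \<Rightarrow> bool" where
  "ahlfors_admissible X f \<longleftrightarrow>
     sphere_holomorphic_on f X \<and> f ` X \<subseteq> ball 0 1 \<and> f None = 0"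

definition ahlfors_maximizer :: "riemann_sphere set \<Rightarrow> (riemann_sphere \<Rightarrow> complex) \<Rightarrow> bool" where
  "ahlfors_maximizer X f \<longleftrightarrow>
     ahlfors_admissible X f \<and>
     (\<forall>g. ahlfors_admissible X g \<longrightarrow> Re (deriv_inf g) \<le> Re (deriv_inf f))"

text \<open>
  Functions on \<open>X\<close> are represented by total functions whose values off \<open>X\<close> are irrelevant, so
  uniqueness of the maximizer means agreement on \<open>X\<close>.
\<close>

definition is_ahlfors_function :: "riemann_sphere set \<Rightarrow> (riemann_sphere \<Rightarrow> complex) \<Rightarrow> bool" where
  "is_ahlfors_function X f \<longleftrightarrow>
     sphere_domain X \<and> None \<in> X \<and> ahlfors_maximizer X f \<and>
     (\<forall>g. ahlfors_maximizer X g \<longrightarrow> (\<forall>x\<in>X. g x = f x))"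

text \<open>
  The self-map of the sphere given by \<open>p/q\<close>, meaningful for coprime \<open>p\<close>, \<open>q\<close> with \<open>q \<noteq> 0\<close>. With
  \<open>d = max (degree p) (degree q)\<close>, its value at infinity is the ratio of the coefficients of \<open>z^d\<close>.
\<close>

definition rational_fun :: "complex poly \<Rightarrow> complex poly \<Rightarrow> riemann_sphere \<Rightarrow> riemann_sphere" where
  "rational_fun p q x =
     (let d = max (degree p) (degree q);
          u = (case x of Some z \<Rightarrow> poly p z | None \<Rightarrow> coeff p d);
          v = (case x of Some z \<Rightarrow> poly q z | None \<Rightarrow> coeff q d)
      in if v = 0 then None else Some (u / v))"

definition rational_map_of_degree :: "nat \<Rightarrow> (riemann_sphere \<Rightarrow> riemann_sphere) \<Rightarrow> bool" where
  "rational_map_of_degree n R \<longleftrightarrow>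
     (\<exists>p q. q \<noteq> 0 \<and> coprime p q \<and> max (degree p) (degree q) = n \<and> R = rational_fun p q)"

definition good_rational_map :: "nat \<Rightarrow> (riemann_sphere \<Rightarrow> riemann_sphere) \<Rightarrow> bool" where
  "good_rational_map n R \<longleftrightarrow>
     rational_map_of_degree n R \<and>
     R None = Some 0 \<and>
     connectedin sphere_top (R -` unit_disk) \<and>
     finite (connected_components_of (subtopology sphere_top (R -` (- unit_disk)))) \<and>
     card (connected_components_of (subtopology sphere_top (R -` (- unit_disk)))) = n"

text \<open>On \<open>R -` unit_disk\<close> the map \<open>R\<close> has finite values, so \<open>the \<circ> R\<close> is \<open>R\<close> as a complex function.\<close>

definition rational_ahlfors_function :: "nat \<Rightarrow> (riemann_sphere \<Rightarrow> riemann_sphere) \<Rightarrow> bool" where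
  "rational_ahlfors_function n R \<longleftrightarrow>
     good_rational_map n R \<and> is_ahlfors_function (R -` unit_disk) (the \<circ> R)"

end

theory Submission
  imports Defs "HOL-Complex_Analysis.Conformal_Mappings"
begin

text \<open>
  Polar coordinates give the topology: moving \<open>z\<close> along a circle towards the nearest ray on which
  \<open>z\<^sup>n\<close> is negative decreases \<open>\<bar>R z\<bar>\<close>, and \<open>\<bar>R\<bar> < 1\<close> on these rays by the bound on \<open>a\<close>, so the
  finite part of the domain is connected through \<open>0\<close>; moving towards the rays \<open>z\<^sup>n > 0\<close> instead
  connects each point of the complement to a unique \<open>n\<close>-th root of unity.

  For extremality, let \<open>h\<close> be admissible and let \<open>g\<close> be the mean of the functions
  \<open>h\<^sub>k z = \<omega>\<^sup>k h (\<omega>\<^sup>k z)\<close>, where \<open>\<omega>\<close> is a primitive \<open>n\<close>-th root of unity. Then \<open>g\<close> has the same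
  derivative at infinity as \<open>h\<close>, and \<open>\<omega> g (\<omega> z) = g z\<close> forces a zero of order \<open>n - 1\<close> at \<open>0\<close>. So
  \<open>g / R\<close> is holomorphic, and it is bounded by 1 because \<open>\<bar>R\<bar> \<rightarrow> 1\<close> at the boundary. If equality holds,
  then \<open>g = R\<close>, and \<open>\<Sum>\<^sub>k \<bar>h\<^sub>k - R\<bar>\<^sup>2 = \<Sum>\<^sub>k \<bar>h\<^sub>k\<bar>\<^sup>2 - n \<bar>R\<bar>\<^sup>2 \<le> n (1 - \<bar>R\<bar>\<^sup>2)\<close> shows that \<open>h - R\<close> tends
  to 0 at the boundary, hence vanishes.
\<close>

subsection \<open>The plane domain and its complement\<close>

lemma norm_exp_minus_one_sq:
  "(norm (exp L - 1))\<^sup>2 = exp (Re L) ^ 2 + 1 - 2 * exp (Re L) * cos (Im L)"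
proof -
  have "(norm (exp L - 1))\<^sup>2 = (exp (Re L) * cos (Im L) - 1)^2 + (exp (Re L) * sin (Im L))^2"
    by (simp add: cmod_power2 Re_exp Im_exp)
  also have "\<dots> = exp (Re L) ^ 2 * ((sin (Im L))\<^sup>2 + (cos (Im L))\<^sup>2) + 1 - 2 * exp (Re L) * cos (Im L)"
    by algebra
  finally show ?thesis by simp
qed

lemma norm_exp_plus_one_sq:
  "(norm (exp L + 1))\<^sup>2 = exp (Re L) ^ 2 + 1 + 2 * exp (Re L) * cos (Im L)"
proof -
  have "(norm (exp L + 1))\<^sup>2 = (exp (Re L) * cos (Im L) + 1)^2 + (exp (Re L) * sin (Im L))^2"
    by (simp add: cmod_power2 Re_exp Im_exp)
  also have "\<dots> = exp (Re L) ^ 2 * ((sin (Im L))\<^sup>2 + (cos (Im L))\<^sup>2) + 1 + 2 * exp (Re L) * cos (Im L)"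
    by algebra
  finally show ?thesis by simp
qed

lemma cos_le_cos_of_abs_le:
  fixes x y :: real
  assumes "\<bar>x\<bar> \<le> \<bar>y\<bar>" "\<bar>y\<bar> \<le> pi"
  shows "cos y \<le> cos x"
  using cos_monotone_0_pi_le[of "\<bar>x\<bar>" "\<bar>y\<bar>"] assms by simp

text \<open>With the real part fixed, the squared modulus depends only on the cosine of the
  imaginary part, which decreases in the size of the angle up to \<open>pi\<close>.\<close>

lemma norm_exp_minus_one_le:
  assumes "Re M = Re L" "\<bar>Im M\<bar> \<le> \<bar>Im L\<bar>" "\<bar>Im L\<bar> \<le> pi"
  shows "norm (exp M - 1) \<le> norm (exp L - 1)"
  by (rule power2_le_imp_le)
     (use cos_le_cos_of_abs_le[of "Im M" "Im L"] assms in \<open>simp_all add: norm_exp_minus_one_sq\<close>)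

lemma norm_exp_plus_one_ge:
  assumes "Re M = Re L" "\<bar>Im M\<bar> \<le> \<bar>Im L\<bar>" "\<bar>Im L\<bar> \<le> pi"
  shows "norm (exp L + 1) \<le> norm (exp M + 1)"
  by (rule power2_le_imp_le)
     (use cos_le_cos_of_abs_le[of "Im M" "Im L"] assms in \<open>simp_all add: norm_exp_plus_one_sq\<close>)

lemma closed_segment_to_real_part:
  assumes "M \<in> closed_segment L (complex_of_real (Re L))"
  shows "Re M = Re L" "\<bar>Im M\<bar> \<le> \<bar>Im L\<bar>"
proof -
  obtain u where u: "0 \<le> u" "u \<le> 1" "M = (1 - u) *\<^sub>R L + u *\<^sub>R complex_of_real (Re L)"
    using assms by (auto simp: closed_segment_def)
  show "Re M = Re L" unfolding u(3) by (simp add: algebra_simps)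
  have "\<bar>Im M\<bar> = (1-u) * \<bar>Im L\<bar>" using u by (simp add: abs_mult)
  also have "\<dots> \<le> 1 * \<bar>Im L\<bar>" using u by (intro mult_right_mono) auto
  finally show "\<bar>Im M\<bar> \<le> \<bar>Im L\<bar>" by simp
qed

lemma connected_component_image_segment:
  fixes f :: "complex \<Rightarrow> complex"
  assumes "continuous_on (closed_segment p q) f" "f ` closed_segment p q \<subseteq> S"
  shows "connected_component S (f p) (f q)"
  unfolding connected_component_def
  using assms connected_continuous_image[OF assms(1)]
  by (intro exI[of _ "f ` closed_segment p q"]) auto

lemma exp_div_nat_power:
  fixes x :: complex
  shows "n > 0 \<Longrightarrow> exp (x / of_nat n) ^ n = exp x"
  by (simp add: exp_divide_power_eq)

text \<open>The last assumption is \<open>\<bar>R z\<bar> < 1\<close> at the points where \<open>z\<^sup>n = - t\<^sup>n\<close>.\<close>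

locale small_parameter =
  fixes n :: nat and a :: real
  assumes n2: "2 \<le> n" and a0: "0 < a"
    and bound: "\<And>t. 0 \<le> t \<Longrightarrow> a * t ^ (n - 1) < t ^ n + 1"
begin

text \<open>The inequality |R z| < 1 with the denominator cleared. In quotient form the convention
  \<open>x / 0 = 0\<close> would admit the poles.\<close>

definition U :: "complex set" where
  "U = {z. a * norm z ^ (n - 1) < norm (z ^ n - 1)}"

lemma n_pos [simp]: "n > 0" "n \<noteq> 0" "n - Suc 0 > 0"
  using n2 by auto

lemma Suc_n [simp]: "Suc (n - Suc 0) = n"
  using n2 by auto

lemma power_n: "z * z ^ (n - 1) = z ^ n" for z :: "'b::monoid_mult"
  by (metis Suc_n One_nat_def power_Suc)

lemma norm_eq_1_of_power:
  fixes F :: complex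
  assumes "norm (F ^ n) = 1"
  shows "norm F = 1"
  using assms power_eq_imp_eq_base[of "norm F" n 1] by (simp add: norm_power)

lemma norm_scaled_exp:
  assumes "norm F = 1"
  shows "norm (F * exp (M / of_nat n)) ^ (n - 1) = exp (Re M / n) ^ (n - 1)"
  using assms by (simp add: norm_mult)

lemma scaled_exp_power:
  fixes F :: complex
  shows "(F * exp (M / of_nat n)) ^ n = F ^ n * exp M"
  by (simp add: power_mult_distrib exp_div_nat_power)

lemma zero_in_U: "0 \<in> U"
  using bound[of 0] by (simp add: U_def zero_power)

text \<open>The path has two legs. In the coordinate \<open>M\<close> with
  \<open>f M ^ n = - exp M\<close>, shrinking the imaginary part to 0 moves \<open>z\<close> along
  its circle to a ray where the \<open>n\<close>-th power is negative, and |R| does not increase.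
  The ray then leads to 0.\<close>

lemma connected_component_U_zero:
  assumes "z \<in> U"
  shows "connected_component U z 0"
proof (cases "z = 0")
  case True
  then show ?thesis using assms by simp
next
  case False
  \<comment> \<open>The sign makes \<open>Im L\<close> the angle of \<open>z ^ n\<close> against the
    negative axis; the principal branch keeps it within \<open>pi\<close>, where the cosine is
    monotone.\<close>
  define L where "L = Ln (- (z ^ n))"
  have eL: "exp L = - (z ^ n)"
    unfolding L_def using False by (simp add: exp_Ln)
  have ImL: "\<bar>Im L\<bar> \<le> pi"
    unfolding L_def using False mpi_less_Im_Ln[of "-(z^n)"] Im_Ln_le_pi[of "-(z^n)"] by auto
  define F where "F = z / exp (L / of_nat n)"
  have zF: "z = F * exp (L / of_nat n)"
    by (simp add: F_def)
  have Fn: "F ^ n = -1"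
    using False eL by (simp add: F_def power_divide exp_div_nat_power divide_simps)
  then have F1: "norm F = 1"
    by (simp add: norm_eq_1_of_power)
  define f where "f M = F * exp (M / of_nat n)" for M
  have f_U: "f M \<in> U \<longleftrightarrow> a * exp (Re M / n) ^ (n - 1) < norm (exp M + 1)" for M
    using norm_minus_cancel[of "exp M + 1"]
    unfolding U_def f_def mem_Collect_eq norm_scaled_exp[OF F1] scaled_exp_power Fn by simp
  have "connected_component U (f L) (f (complex_of_real (Re L)))"
  proof (rule connected_component_image_segment[where f = f])
    show "continuous_on (closed_segment L (complex_of_real (Re L))) f"
      unfolding f_def by (intro continuous_intros) auto
    show "f ` closed_segment L (complex_of_real (Re L)) \<subseteq> U"
    proof clarify
      fix M assume "M \<in> closed_segment L (complex_of_real (Re L))"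
      note M = closed_segment_to_real_part[OF this]
      have "f L \<in> U" using assms zF by (simp add: f_def)
      then show "f M \<in> U"
        using M norm_exp_plus_one_ge[OF M ImL] unfolding f_U by simp
    qed
  qed
  \<comment> \<open>On the ray, \<open>w ^ n = - (r ^ n)\<close> with \<open>r\<close> the modulus
    of \<open>w\<close>, which is the case covered by \<open>bound\<close>.\<close>
  moreover have "connected_component U (f (complex_of_real (Re L))) 0"
  proof (rule connected_component_image_segment[where f = "\<lambda>x. x"])
    show "(\<lambda>x. x) ` closed_segment (f (complex_of_real (Re L))) 0 \<subseteq> U"
    proof clarify
      fix w assume "w \<in> closed_segment (f (complex_of_real (Re L))) 0"
      then obtain u where u: "0 \<le> u" "u \<le> 1" "w = (1-u) *\<^sub>R f (complex_of_real (Re L))"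
        by (auto simp: closed_segment_def)
      define r where "r = (1-u) * exp (Re L / n)"
      have r: "r \<ge> 0" using u by (simp add: r_def)
      have w: "w = F * of_real r"
        unfolding u f_def r_def by (simp add: scaleR_conv_of_real exp_of_real[symmetric] mult_ac)
      have "w ^ n - 1 = - of_real (r ^ n + 1)"
        unfolding w by (simp add: power_mult_distrib Fn)
      then have "norm (w ^ n - 1) = r ^ n + 1"
        using r by (simp only: norm_minus_cancel norm_of_real) simp
      moreover have "norm w = r"
        unfolding w using r F1 by (simp add: norm_mult)
      ultimately show "w \<in> U"
        using bound[OF r] by (simp add: U_def)
    qed
  qed (auto intro: continuous_intros)
  ultimately have "connected_component U (f L) 0"
    by (rule connected_component_trans)
  then show ?thesis
    using zF by (simp add: f_def)
qed

lemma connected_U: "connected U"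
  unfolding connected_iff_connected_component
  by (meson connected_component_U_zero connected_component_sym connected_component_trans)

section \<open>The components of the complement\<close>

definition nearest_root :: "complex \<Rightarrow> complex" where
  "nearest_root z = z * exp (- (Ln (z ^ n) / of_nat n))"

text \<open>If \<open>z ^ n\<close> is real and nonpositive, its distance to 1 is
  \<open>norm z ^ n + 1\<close>, and \<open>bound\<close> puts \<open>z\<close> into
  \<open>U\<close>. Hence \<open>Ln (z ^ n)\<close> meets no branch cut on the complement.\<close>

lemma notin_U_power:
  assumes "z \<notin> U"
  shows "z ^ n \<notin> \<real>\<^sub>\<le>\<^sub>0"
proof
  assume "z ^ n \<in> \<real>\<^sub>\<le>\<^sub>0"
  then obtain r where r: "z ^ n = of_real r" "r \<le> 0" by (auto elim!: nonpos_Reals_cases)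
  have "norm (z ^ n - 1) = 1 - r"
    using r by (metis abs_of_nonneg diff_ge_0_iff_ge norm_minus_commute norm_of_real of_real_1 of_real_diff order.trans zero_le_one)
  moreover have "norm z ^ n = - r"
    using r by (metis abs_of_nonpos norm_of_real norm_power)
  ultimately show False
    using bound[of "norm z"] assms by (simp add: U_def)
qed

text \<open>Dividing \<open>z\<close> by the principal \<open>n\<close>-th root of
  \<open>z ^ n\<close> leaves a root of unity, one that is nearest to \<open>z\<close> in
  argument.\<close>

lemma nearest_root_power:
  assumes "z \<noteq> 0"
  shows "nearest_root z ^ n = 1"
  using assms by (simp add: nearest_root_def power_mult_distrib exp_minus power_inverse exp_div_nat_power)

lemma continuous_nearest_root: "continuous_on (- U) nearest_root"
  unfolding nearest_root_def using notin_U_power by (intro continuous_intros) auto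

lemma root_notin_U:
  assumes "z ^ n = 1"
  shows "z \<notin> U"
  using assms a0 by (simp add: U_def not_less)

lemma nearest_root_root:
  assumes "z ^ n = 1"
  shows "nearest_root z = z"
  using assms by (simp add: nearest_root_def)

text \<open>Here \<open>x\<close> is the logarithm of the \<open>n\<close>-th power of the radius.
  Below 0, moving up towards 0 decreases the left side and increases the right side. Above 0,
  division by \<open>exp (u / n) ^ (n - 1)\<close> leaves an increasing function of \<open>u\<close>
  on the left and the constant \<open>a\<close> on the right.\<close>

lemma radial_bound:
  assumes x: "\<bar>exp x - 1\<bar> \<le> a * exp (x / n) ^ (n - 1)" and u: "u \<in> closed_segment x 0"
  shows "\<bar>exp u - 1\<bar> \<le> a * exp (u / n) ^ (n - 1)"
proof (cases "u < 0")
  case True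
  then have "x \<le> u" using u by (auto simp: closed_segment_eq_real_ivl split: if_splits)
  then have "exp x \<le> exp u" "exp x \<le> 1" "exp u \<le> 1" "a * exp (x / n) ^ (n - 1) \<le> a * exp (u / n) ^ (n - 1)"
    using True a0 by (auto intro!: mult_left_mono power_mono simp: divide_right_mono)
  then show ?thesis using x by linarith
next
  case u0: False
  have *: "\<bar>exp v - 1\<bar> \<le> a * exp (v / n) ^ (n - 1) \<longleftrightarrow> exp (v / n) - exp (- (v / n)) ^ (n - 1) \<le> a"
    if "v \<ge> 0" for v :: real
  proof -
    have "exp v = exp (v / n) * exp (v / n) ^ (n - 1)"
      unfolding power_n by (simp add: exp_divide_power_eq)
    moreover have "exp (- (v / n)) ^ (n - 1) * exp (v / n) ^ (n - 1) = 1"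
      by (simp add: power_mult_distrib[symmetric] exp_minus)
    ultimately have "exp v - 1 = (exp (v / n) - exp (- (v / n)) ^ (n - 1)) * exp (v / n) ^ (n - 1)"
      by (simp add: algebra_simps)
    moreover have "\<bar>exp v - 1\<bar> = exp v - 1" using that by simp
    ultimately show ?thesis
      by (simp del: One_nat_def)
  qed
  show ?thesis
  proof (cases "u = 0")
    case True
    then show ?thesis using a0 by simp
  next
  case False
  have ux: "0 \<le> u" "u \<le> x" using u u0 False by (auto simp: closed_segment_eq_real_ivl split: if_splits)
  then have le: "exp (u / n) \<le> exp (x / n)" "exp (- (x / n)) ^ (n - 1) \<le> exp (- (u / n)) ^ (n - 1)"
    by (auto intro!: power_mono simp: divide_right_mono)
  then show ?thesis
    using x le *[of x] *[of u] ux by linarith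
  qed
qed

text \<open>Two legs as for \<open>U\<close>, now with \<open>exp L = z ^ n\<close>: along the
  circle to a ray where the \<open>n\<close>-th power is positive, then along this ray to radius 1,
  where \<open>radial_bound\<close> keeps the path in the complement.\<close>

lemma connected_component_nearest_root:
  assumes "z \<notin> U"
  shows "connected_component (- U) z (nearest_root z)"
proof -
  have z0: "z \<noteq> 0" using assms zero_in_U by auto
  define L where "L = Ln (z ^ n)"
  have eL: "exp L = z ^ n"
    unfolding L_def using z0 by simp
  have ImL: "\<bar>Im L\<bar> \<le> pi"
    unfolding L_def using z0 mpi_less_Im_Ln[of "z^n"] Im_Ln_le_pi[of "z^n"] by auto
  define F where "F = nearest_root z"
  have zF: "z = F * exp (L / of_nat n)"
    by (simp add: F_def nearest_root_def L_def exp_minus)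
  have Fn: "F ^ n = 1"
    using z0 by (simp add: F_def nearest_root_power)
  then have F1: "norm F = 1"
    by (simp add: norm_eq_1_of_power)
  define f where "f M = F * exp (M / of_nat n)" for M
  have f_U: "f M \<notin> U \<longleftrightarrow> norm (exp M - 1) \<le> a * exp (Re M / n) ^ (n - 1)" for M
    unfolding U_def f_def mem_Collect_eq norm_scaled_exp[OF F1] scaled_exp_power Fn by (simp add: not_less)
  have cont: "continuous_on S f" for S
    unfolding f_def by (intro continuous_intros) auto
  have fL: "f (of_real (Re L)) \<notin> U" if "f L \<notin> U"
    using that norm_exp_minus_one_le[of "of_real (Re L)" L] ImL unfolding f_U by simp
  have fLU: "f L \<notin> U" using assms zF by (simp add: f_def)
  have "connected_component (- U) (f L) (f (complex_of_real (Re L)))"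
  proof (rule connected_component_image_segment[OF cont])
    show "f ` closed_segment L (complex_of_real (Re L)) \<subseteq> - U"
    proof clarify
      fix M assume "M \<in> closed_segment L (complex_of_real (Re L))" and "f M \<in> U"
      note M = closed_segment_to_real_part[OF this(1)]
      show False
        using M norm_exp_minus_one_le[OF M ImL] fLU \<open>f M \<in> U\<close> f_U[of M] f_U[of L] by simp
    qed
  qed
  moreover have "connected_component (- U) (f (complex_of_real (Re L))) (f 0)"
  proof (rule connected_component_image_segment[OF cont])
    show "f ` closed_segment (complex_of_real (Re L)) 0 \<subseteq> - U"
    proof clarify
      fix M assume "M \<in> closed_segment (complex_of_real (Re L)) 0" and M: "f M \<in> U"
      then obtain u where u: "u \<in> closed_segment (Re L) 0" "M = of_real u"
        using closed_segment_of_real[of "Re L" 0] by auto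
      have ab: "norm (exp (complex_of_real v) - 1) = \<bar>exp v - 1\<bar>" for v
        by (metis exp_of_real norm_of_real of_real_1 of_real_diff)
      have "\<bar>exp (Re L) - 1\<bar> \<le> a * exp (Re L / n) ^ (n - 1)"
        using fL[OF fLU] unfolding f_U by (simp add: ab)
      from radial_bound[OF this u(1)] have "f M \<notin> U"
        unfolding f_U u(2) by (simp add: ab)
      then show False using M by simp
    qed
  qed
  ultimately have "connected_component (- U) (f L) (f 0)"
    by (rule connected_component_trans)
  moreover have "f L = z"
    unfolding f_def by (rule zF[symmetric])
  moreover have "f 0 = nearest_root z"
    by (simp add: f_def F_def)
  ultimately show ?thesis by simp
qed

text \<open>A continuous function with finitely many values is constant on connected sets, and off
  \<open>U\<close> the values of \<open>nearest_root\<close> are roots of unity.\<close>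

lemma nearest_root_eq_of_connected:
  assumes "connected_component (- U) z w"
  shows "nearest_root z = nearest_root w"
proof -
  obtain T where T: "connected T" "T \<subseteq> - U" "z \<in> T" "w \<in> T"
    using assms unfolding connected_component_def by auto
  have "nearest_root ` T \<subseteq> {z. z ^ n = 1}"
  proof clarify
    fix x assume "x \<in> T"
    then have "x \<noteq> 0" using T zero_in_U by auto
    then show "nearest_root x ^ n = 1" by (rule nearest_root_power)
  qed
  then have "finite (nearest_root ` T)"
    by (rule finite_subset) (use n2 in \<open>auto intro: finite_roots_unity\<close>)
  then have "nearest_root constant_on T"
    using continuous_finite_range_constant T continuous_on_subset[OF continuous_nearest_root]
    by blast
  then show ?thesis using T unfolding constant_on_def by metis
qed

lemma components_notin_U: "components (- U) = connected_component_set (- U) ` {z. z ^ n = 1}"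
proof -
  have "connected_component_set (- U) z \<in> connected_component_set (- U) ` {z. z ^ n = 1}" if "z \<notin> U" for z
    using connected_component_nearest_root[OF that] nearest_root_power[of z] zero_in_U that
    by (metis (mono_tags, lifting) connected_component_eq image_eqI mem_Collect_eq)
  then show ?thesis
    using root_notin_U by (auto simp: components_def)
qed

text \<open>Distinct roots of unity lie in distinct components, because \<open>nearest_root\<close>
  fixes each of them and is constant on components.\<close>

lemma card_components_notin_U: "card (components (- U)) = n"
proof -
  have "inj_on (connected_component_set (- U)) {z. z ^ n = 1}"
  proof (rule inj_onI)
    fix z w assume zw: "z \<in> {z. z ^ n = 1}" "w \<in> {z. z ^ n = 1}"
      "connected_component_set (- U) z = connected_component_set (- U) w"
    then have "connected_component (- U) z w"
      using root_notin_U by (metis ComplI connected_component_refl mem_Collect_eq)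
    from nearest_root_eq_of_connected[OF this] show "z = w"
      using zw nearest_root_root by simp
  qed
  then show ?thesis
    unfolding components_notin_U by (subst card_image) (auto simp: card_roots_unity_eq)
qed

end

subsection \<open>Transfer to the sphere\<close>

lemma connected_components_of_top_of_set:
  "connected_components_of (top_of_set S) = components S"
proof -
  have "connected_component_of_set (top_of_set S) x = connected_component_set S x" for x
    by (auto simp: connected_component_of_def connected_component_def connectedin_subtopology)
  then show ?thesis
    by (simp add: connected_components_of_def components_def)
qed

text \<open>\<open>Some\<close> embeds the plane into its compactification, so components of sets
  that omit infinity can be counted in the plane.\<close>

lemma connected_components_of_image_Some:
  "connected_components_of (subtopology sphere_top (Some ` S)) = (image Some) ` components S"
proof -
  have "homeomorphic_map (top_of_set S)
          (subtopology (subtopology sphere_top (Some ` topspace euclidean)) (Some ` S)) Some"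
    using embedding_map_Some[of "euclidean :: complex topology"]
    unfolding embedding_map_def sphere_top_def
    by (intro homeomorphic_map_subtopologies) auto
  moreover have "Some ` topspace (euclidean :: complex topology) \<inter> Some ` S = Some ` S" by auto
  ultimately have "homeomorphic_map (top_of_set S) (subtopology sphere_top (Some ` S)) Some"
    by (simp add: subtopology_subtopology)
  from homeomorphic_map_connected_components_of[OF this] show ?thesis
    by (simp add: connected_components_of_top_of_set)
qed

lemma openin_sphere_top_compact_complement:
  assumes "compact (- V)"
  shows "openin sphere_top (insert None (Some ` V))"
  unfolding sphere_top_def openin_Alexandroff_compactification
  using assms by (intro disjI2 exI[of _ "- V"]) (auto simp: compact_imp_closed)

text \<open>Every neighbourhood of infinity contains the complement of a compact set and so meets
  the unbounded \<open>V\<close>. Thus infinity is a closure point, and adding it preserves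
  connectedness.\<close>

lemma connectedin_sphere_top_insert_None:
  assumes "connected V" "\<not> bounded V"
  shows "connectedin sphere_top (insert None (Some ` V))"
proof (rule connectedin_intermediate_closure_of)
  show "connectedin sphere_top (Some ` V)"
    unfolding sphere_top_def
    by (rule connectedin_continuous_map_image[OF continuous_map_Some]) (use assms in simp)
  show "Some ` V \<subseteq> insert None (Some ` V)" by auto
  have "None \<in> sphere_top closure_of (Some ` V)"
    unfolding in_closure_of
  proof (intro conjI allI impI)
    fix T assume "None \<in> T \<and> openin sphere_top T"
    then obtain C where C: "compact C" "T = insert None (Some ` (- C))"
      unfolding sphere_top_def openin_Alexandroff_compactification by (auto simp: Compl_eq_Diff_UNIV)
    then obtain z where "z \<in> V" "z \<notin> C"
      using assms(2) compact_imp_bounded bounded_subset by blast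
    then show "\<exists>y. y \<in> Some ` V \<and> y \<in> T"
      using C by auto
  qed (simp add: sphere_top_def)
  moreover have "Some ` V \<subseteq> sphere_top closure_of (Some ` V)"
    by (rule closure_of_subset) (auto simp: sphere_top_def)
  ultimately show "insert None (Some ` V) \<subseteq> sphere_top closure_of (Some ` V)" by simp
qed

lemma degree_monom_minus_one:
  assumes "0 < n"
  shows "degree (monom (1::complex) n - 1) = n"
proof (rule antisym)
  show "degree (monom (1::complex) n - 1) \<le> n"
    by (rule degree_diff_le) (simp_all add: degree_monom_le)
  show "n \<le> degree (monom (1::complex) n - 1)"
    using assms by (intro le_degree) simp
qed

section \<open>The rational map and its domain on the sphere\<close>

context small_parameter
begin

definition R :: "riemann_sphere \<Rightarrow> riemann_sphere" where
  "R = rational_fun (monom (complex_of_real a) (n - 1)) (monom 1 n - 1)"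

definition X :: "riemann_sphere set" where
  "X = insert None (Some ` U)"

lemma degree_denominator: "max (degree (monom (complex_of_real a) (n - 1))) (degree (monom (1::complex) n - 1)) = n"
  using a0 n2 by (simp add: degree_monom_minus_one degree_monom_eq)

lemma R_None: "R None = Some 0"
  unfolding R_def rational_fun_def degree_denominator using n2 by simp

lemma R_Some:
  fixes z :: complex
  shows "R (Some z) = (if z ^ n = 1 then None else Some (a * z ^ (n - 1) / (z ^ n - 1)))"
  unfolding R_def rational_fun_def degree_denominator using n2 by (simp add: poly_monom)

lemma rational_map_of_degree_R: "rational_map_of_degree n R"
proof -
  have "coprime (monom (complex_of_real a) (n - 1)) (monom 1 n - 1)"
  proof (rule coprimeI)
    fix c assume c: "c dvd monom (complex_of_real a) (n - 1)" "c dvd monom 1 n - 1"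
    \<comment> \<open>A Bezout identity: z / a times the numerator is z^n, which exceeds the
      denominator by 1.\<close>
    have "monom (1 / complex_of_real a) 1 * monom (complex_of_real a) (n - 1) - (monom 1 n - 1) = 1"
      using a0 by (simp add: mult_monom)
    then show "is_unit c"
      using c by (metis dvd_diff dvd_mult)
  qed
  moreover have "monom (1::complex) n - 1 \<noteq> 0"
    using degree_monom_minus_one[of n] by (metis degree_0 n_pos(1) n_pos(2))
  ultimately show ?thesis
    unfolding rational_map_of_degree_def R_def using degree_denominator by blast
qed

lemma R_Some_in_disk: "R (Some z) \<in> unit_disk \<longleftrightarrow> z \<in> U"
proof (cases "z ^ n = 1")
  case True
  then show ?thesis using root_notin_U by (auto simp: R_Some unit_disk_def)
next
  case False
  then have "norm (z ^ n - 1) > 0" by simp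
  then show ?thesis
    using False a0 by (auto simp: R_Some unit_disk_def U_def norm_divide norm_mult norm_power divide_less_eq)
qed

lemma vimage_R_disk: "R -` unit_disk = X"
proof -
  have "x \<in> R -` unit_disk \<longleftrightarrow> x \<in> X" for x
    by (cases x) (auto simp: X_def R_None R_Some_in_disk, auto simp: unit_disk_def)
  then show ?thesis by blast
qed

lemma vimage_R_compl_disk: "R -` (- unit_disk) = Some ` (- U)"
proof -
  have "x \<in> R -` (- unit_disk) \<longleftrightarrow> x \<in> Some ` (- U)" for x
    by (cases x) (auto simp: R_None R_Some_in_disk, auto simp: unit_disk_def)
  then show ?thesis by blast
qed

lemma open_U: "open U"
  unfolding U_def by (intro open_Collect_less continuous_intros)

text \<open>Beyond radius \<open>a + 1\<close>, the lower bound \<open>norm z ^ n - 1\<close> for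
  the denominator already exceeds \<open>a * norm z ^ (n - 1)\<close>.\<close>

lemma norm_le_of_notin_U:
  assumes "z \<notin> U"
  shows "norm z \<le> a + 1"
proof (rule ccontr)
  assume z: "\<not> norm z \<le> a + 1"
  then have p: "1 \<le> norm z ^ (n - 1)" using a0 by (intro one_le_power) simp
  have "norm z ^ n - 1 \<le> norm (z ^ n - 1)"
    by (metis norm_one norm_power norm_triangle_ineq2)
  also have "\<dots> \<le> a * norm z ^ (n - 1)" using assms by (simp add: U_def)
  finally have "norm z * norm z ^ (n - 1) \<le> a * norm z ^ (n - 1) + 1"
    unfolding power_n by simp
  moreover have "(a + 1) * norm z ^ (n - 1) < norm z * norm z ^ (n - 1)"
    using z p by (intro mult_strict_right_mono) auto
  ultimately show False using p by (simp add: distrib_right)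
qed

lemma compact_notin_U: "compact (- U)"
  unfolding compact_eq_bounded_closed bounded_iff
  using norm_le_of_notin_U open_U by (auto simp: closed_Compl)

lemma unbounded_U: "\<not> bounded U"
proof
  assume "bounded U"
  then have "bounded (U \<union> - U)"
    using compact_imp_bounded[OF compact_notin_U] by (simp only: bounded_Un)
  then show False by (simp add: Un_commute)
qed

lemma openin_X: "openin sphere_top X"
  unfolding X_def by (rule openin_sphere_top_compact_complement[OF compact_notin_U])

lemma connectedin_X: "connectedin sphere_top X"
  unfolding X_def by (rule connectedin_sphere_top_insert_None[OF connected_U unbounded_U])

lemma good_R: "good_rational_map n R"
proof -
  have "card (connected_components_of (subtopology sphere_top (R -` (- unit_disk)))) = n"
    unfolding vimage_R_compl_disk connected_components_of_image_Some
    by (subst card_image) (auto intro!: inj_onI simp: inj_image_eq_iff card_components_notin_U)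
  then show ?thesis
    unfolding good_rational_map_def
    using rational_map_of_degree_R R_None connectedin_X vimage_R_disk card_ge_0_finite by force
qed

lemma sphere_domain_X: "sphere_domain X"
  using openin_X connectedin_X by (auto simp: sphere_domain_def X_def)

end

subsection \<open>Charts at infinity and the maximum principle\<close>

text \<open>Since the mean is \<open>F\<close>, expanding the squares gives a total variance of the
  sum of |c k|^2 minus n |F|^2. A single term is at most the whole sum.\<close>

lemma norm_average_bound:
  fixes c :: "nat \<Rightarrow> complex"
  assumes c: "\<And>k. k < n \<Longrightarrow> norm (c k) \<le> 1" and F: "(\<Sum>k<n. c k) = of_nat n * F" and j: "j < n"
  shows "(norm (c j - F))\<^sup>2 \<le> n * (1 - (norm F)\<^sup>2)"
proof -
  have sq: "(norm (c k - F))\<^sup>2 = (norm (c k))\<^sup>2 - 2 * Re (cnj F * c k) + (norm F)\<^sup>2" for k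
    unfolding cmod_power2 by (simp add: power2_eq_square algebra_simps)
  have "(\<Sum>k<n. Re (cnj F * c k)) = Re (cnj F * (\<Sum>k<n. c k))"
    by (simp add: sum_distrib_left)
  also have "\<dots> = n * (norm F)\<^sup>2"
    unfolding F cmod_power2 by (simp add: power2_eq_square algebra_simps)
  finally have cross: "(\<Sum>k<n. Re (cnj F * c k)) = n * (norm F)\<^sup>2" .
  have "(norm (c j - F))\<^sup>2 \<le> (\<Sum>k<n. (norm (c k - F))\<^sup>2)"
    by (rule member_le_sum) (use j in auto)
  also have "\<dots> = (\<Sum>k<n. (norm (c k))\<^sup>2) - 2 * (\<Sum>k<n. Re (cnj F * c k)) + n * (norm F)\<^sup>2"
    unfolding sq by (simp add: sum.distrib sum_subtractf sum_distrib_left)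
  also have "\<dots> = (\<Sum>k<n. (norm (c k))\<^sup>2) - n * (norm F)\<^sup>2"
    unfolding cross by simp
  also have "(\<Sum>k<n. (norm (c k))\<^sup>2) \<le> (\<Sum>k<n. 1)"
    using c by (intro sum_mono) (simp add: power_le_one)
  finally show ?thesis by (simp add: algebra_simps)
qed

section \<open>Rotations and zeros at the origin\<close>

lemma primitive_root_power_neq_1:
  fixes j n :: nat
  assumes "0 < j" "j < n"
  shows "cis (2 * pi / n) ^ j \<noteq> 1"
proof
  assume "cis (2 * pi / n) ^ j = 1"
  moreover have "cis (2 * pi / n) ^ j = cis (2 * pi * real j / real n)"
    unfolding Complex.DeMoivre by (rule arg_cong[where f = cis]) simp
  ultimately have "cis (2 * pi * real j / real n) = cis (2 * pi * real 0 / real n)"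
    by simp
  moreover have inj: "inj_on (\<lambda>k. cis (2 * pi * real k / real n)) {..<n}"
    using Complex.bij_betw_roots_unity[of n] assms by (simp add: bij_betw_def)
  ultimately have "j = 0"
    using inj_onD[OF inj, of j 0] assms by simp
  then show False using assms by simp
qed

text \<open>Only the Taylor coefficients of order congruent to \<open>- k\<close> modulo the order of \<open>\<omega>\<close> can survive.\<close>

lemma holomorphic_factor_of_rotation:
  assumes "open U" "0 \<in> U" "f holomorphic_on U"
    and rot: "\<And>z. z \<in> U \<Longrightarrow> \<omega> * z \<in> U" "\<And>z. z \<in> U \<Longrightarrow> \<omega> ^ k * f (\<omega> * z) = f z"
    and \<omega>: "\<And>j. k \<le> j \<Longrightarrow> j < k + m \<Longrightarrow> \<omega> ^ j \<noteq> 1" "\<omega> \<noteq> 0"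
  shows "\<exists>h. h holomorphic_on U \<and> (\<forall>z\<in>U. f z = z ^ m * h z)"
  using assms(3-)
proof (induction m arbitrary: f k)
  case 0
  then show ?case by auto
next
  case (Suc m)
  \<comment> \<open>Each round splits off one factor \<open>z\<close>: as
    \<open>\<omega> ^ k\<close> is not 1, the law at 0 forces \<open>f 0 = 0\<close>, and the
    quotient obeys the law with exponent \<open>Suc k\<close>.\<close>
  define g where "g = (\<lambda>z. if z = 0 then deriv f 0 else (f z - f 0) / (z - 0))"
  have g: "g holomorphic_on U"
    unfolding g_def by (rule pole_lemma_open) (use Suc assms in auto)
  have "\<omega> ^ k * f 0 = f 0"
    using Suc.prems(3)[OF \<open>0 \<in> U\<close>] by simp
  then have f0: "f 0 = 0"
    using Suc.prems(4)[of k] by simp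
  have fg: "f z = z * g z" for z
    using f0 by (simp add: g_def)
  have "\<omega> ^ Suc k * g (\<omega> * z) = g z" if "z \<in> U" for z
  proof (cases "z = 0")
    case False
    then show ?thesis
      using Suc.prems(3)[OF that] \<omega> by (simp add: g_def f0 field_simps)
  next
    case True
    \<comment> \<open>At 0 the quotient is the derivative, so its law comes from differentiating the
      law of \<open>f\<close>.\<close>
    have df: "(f has_field_derivative deriv f 0) (at 0)"
      using Suc.prems(1) assms by (simp add: holomorphic_derivI)
    then have "((\<lambda>z. \<omega> ^ k * f (\<omega> * z)) has_field_derivative \<omega> ^ k * (deriv f 0 * \<omega>)) (at 0)"
      by (auto intro!: derivative_eq_intros DERIV_chain2[where f = f])
    then have "(f has_field_derivative \<omega> ^ k * (deriv f 0 * \<omega>)) (at 0)"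
      by (rule has_field_derivative_transform_within_open[OF _ \<open>open U\<close> \<open>0 \<in> U\<close>]) (use Suc.prems in auto)
    with df have "deriv f 0 = \<omega> ^ k * (deriv f 0 * \<omega>)"
      by (rule DERIV_unique)
    then show ?thesis using True by (simp add: g_def mult_ac)
  qed
  then obtain h where "h holomorphic_on U" "\<forall>z\<in>U. g z = z ^ m * h z"
    using Suc.IH[OF g Suc.prems(2), of "Suc k"] Suc.prems(4) \<open>\<omega> \<noteq> 0\<close> by auto
  then show ?case using fg by (intro exI[of _ h]) simp
qed

text \<open>A Moebius chart of the sphere that sends \<open>0\<close> to \<open>\<infinity>\<close> and \<open>\<infinity>\<close> to \<open>1\<close>.\<close>

definition mobius_chart :: "complex \<Rightarrow> riemann_sphere" where
  "mobius_chart w = (if w = 0 then None else Some (1 + 1 / w))"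

lemma mobius_chart_0 [simp]: "mobius_chart 0 = None"
  by (simp add: mobius_chart_def)

lemma chart_inf_0 [simp]: "chart_inf 0 = None"
  by (simp add: chart_inf_def)

lemma mobius_chart_eq_chart_inf:
  assumes "w \<noteq> -1"
  shows "mobius_chart w = chart_inf (w / (1 + w))"
proof -
  have "1 + w \<noteq> 0" using assms by (metis add_eq_0_iff)
  then show ?thesis by (simp add: mobius_chart_def chart_inf_def field_simps)
qed

text \<open>Away from \<open>w = 0\<close> the chart factors through \<open>Some\<close>; away from
  \<open>w = -1\<close>, which is sent to the origin, it factors through \<open>chart_inf\<close>.
  The two open pieces cover everything.\<close>

lemma holomorphic_mobius_chart:
  assumes "sphere_holomorphic_on f X" "open (mobius_chart -` X)"
  shows "(f \<circ> mobius_chart) holomorphic_on (mobius_chart -` X)"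
proof -
  let ?W = "mobius_chart -` X"
  have f: "(f \<circ> Some) holomorphic_on (Some -` X)" "(f \<circ> chart_inf) holomorphic_on (chart_inf -` X)"
    using assms by (auto simp: sphere_holomorphic_on_def)
  have "((f \<circ> Some) \<circ> (\<lambda>w. 1 + 1 / w)) holomorphic_on (?W - {0})"
    by (rule holomorphic_on_compose_gen[OF _ f(1)])
       (auto intro!: holomorphic_intros simp: mobius_chart_def)
  then have 1: "(f \<circ> mobius_chart) holomorphic_on (?W - {0})"
    by (rule holomorphic_transform) (auto simp: mobius_chart_def)
  have nz: "1 + w \<noteq> 0" if "w \<noteq> -1" for w :: complex
    using that by (metis add_eq_0_iff)
  have "((f \<circ> chart_inf) \<circ> (\<lambda>w. w / (1 + w))) holomorphic_on (?W - {-1})"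
    by (rule holomorphic_on_compose_gen[OF _ f(2)])
       (auto intro!: holomorphic_intros simp: nz mobius_chart_eq_chart_inf)
  then have 2: "(f \<circ> mobius_chart) holomorphic_on (?W - {-1})"
    by (rule holomorphic_transform) (auto simp: mobius_chart_eq_chart_inf)
  have "(f \<circ> mobius_chart) holomorphic_on ((?W - {0}) \<union> (?W - {-1}))"
    using 1 2 assms(2) by (intro holomorphic_on_Un) (auto intro: open_delete)
  then show ?thesis
    by (rule holomorphic_on_subset) auto
qed

text \<open>Under z = 1 / w the expression in \<open>deriv_inf\<close> becomes the difference
  quotient at \<open>w = 0\<close>.\<close>

lemma deriv_inf_chart_inf:
  assumes "((f \<circ> chart_inf) has_field_derivative d) (at 0)"
  shows "deriv_inf f = d"
proof -
  have "((\<lambda>w. (f (chart_inf w) - f None) / w) \<longlongrightarrow> d) (at 0)"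
    using assms unfolding has_field_derivative_iff by (simp add: o_def)
  then have "((\<lambda>w. inverse w * (f (Some (inverse w)) - f None)) \<longlongrightarrow> d) (at 0)"
    by (rule Lim_transform_eventually)
       (auto simp: eventually_at_filter chart_inf_def field_simps intro!: always_eventually)
  then have "((\<lambda>z. z * (f (Some z) - f None)) \<longlongrightarrow> d) at_infinity"
    by (simp add: lim_at_infinity_0 o_def)
  then show ?thesis
    unfolding deriv_inf_def by (intro tendsto_Lim) (simp_all add: trivial_limit_at_infinity)
qed

text \<open>The change of chart \<open>w / (1 + w)\<close> fixes 0 with derivative 1, so the
  derivative at infinity can be read off in either chart.\<close>

lemma deriv_mobius_chart:
  assumes "((f \<circ> chart_inf) has_field_derivative d) (at 0)"
  shows "((f \<circ> mobius_chart) has_field_derivative d) (at 0)"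
proof -
  have "((\<lambda>w. w / (1 + w)) has_field_derivative 1) (at (0::complex))"
    by (auto intro!: derivative_eq_intros)
  then have "(((f \<circ> chart_inf) \<circ> (\<lambda>w. w / (1 + w))) has_field_derivative d * 1) (at 0)"
    by (intro DERIV_chain) (use assms in auto)
  then have "((f \<circ> mobius_chart) has_field_derivative d * 1) (at 0)"
    by (rule has_field_derivative_transform_within_open[of _ _ _ "- {-1}"])
       (auto simp: mobius_chart_eq_chart_inf)
  then show ?thesis by simp
qed

lemma open_chart_inf_vimage:
  assumes "openin sphere_top X" "None \<in> X"
  shows "\<exists>e>0. ball 0 e \<subseteq> chart_inf -` X"
proof -
  obtain C where C: "compact C" "X = insert None (Some ` (- C))"
    using assms unfolding sphere_top_def openin_Alexandroff_compactification by (auto simp: Compl_eq_Diff_UNIV)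
  obtain B where B: "B > 0" "\<And>z. z \<in> C \<Longrightarrow> norm z \<le> B"
    using compact_imp_bounded[OF C(1)] by (auto simp: bounded_pos)
  have "chart_inf w \<in> X" if "norm w < 1 / B" for w
  proof (cases "w = 0")
    case False
    then have "norm (1 / w) > B"
      using that B(1) by (simp add: norm_divide field_simps)
    then show ?thesis using B(2)[of "1 / w"] False C(2) by (auto simp: chart_inf_def)
  qed (simp add: C)
  then show ?thesis using B(1) by (intro exI[of _ "1 / B"]) auto
qed

lemma sphere_holomorphic_deriv_chart_inf:
  assumes "sphere_holomorphic_on f X" "openin sphere_top X" "None \<in> X"
  shows "((f \<circ> chart_inf) has_field_derivative deriv_inf f) (at 0)"
proof -
  obtain e where e: "e > 0" "ball 0 e \<subseteq> chart_inf -` X"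
    using open_chart_inf_vimage[OF assms(2,3)] by auto
  have "(f \<circ> chart_inf) holomorphic_on ball 0 e"
    using assms(1) e(2) unfolding sphere_holomorphic_on_def using holomorphic_on_subset by blast
  then have "((f \<circ> chart_inf) has_field_derivative deriv (f \<circ> chart_inf) 0) (at 0)"
    using e(1) by (intro holomorphic_derivI[where S = "ball 0 e"]) auto
  with deriv_inf_chart_inf[OF this] show ?thesis by simp
qed

section \<open>The domain in the Moebius chart and the maximum principle\<close>

context small_parameter
begin

text \<open>In the Moebius chart \<open>R\<close> becomes \<open>P / Q\<close>, and its domain \<open>W\<close> is bounded.\<close>

definition P :: "complex \<Rightarrow> complex" where
  "P w = complex_of_real a * w * (w + 1) ^ (n - 1)"

definition Q :: "complex \<Rightarrow> complex" where
  "Q w = (w + 1) ^ n - w ^ n"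

definition W :: "complex set" where
  "W = {w. norm (P w) < norm (Q w)}"

lemma P_0 [simp]: "P 0 = 0"
  by (simp add: P_def)

lemma Q_0 [simp]: "Q 0 = 1"
  by (simp add: Q_def)

lemma P_eq_0_iff: "P w = 0 \<longleftrightarrow> w = 0 \<or> w = -1"
  using a0 n2 by (auto simp: P_def add_eq_0_iff2)

text \<open>\<open>P\<close> and \<open>Q\<close> have no common zero, since \<open>P\<close>
  vanishes only at 0 and -1.\<close>

lemma Q_nonzero:
  assumes "norm (P w) \<le> norm (Q w)"
  shows "Q w \<noteq> 0"
proof
  assume Q: "Q w = 0"
  then have "P w = 0" using assms by simp
  then show False using Q by (auto simp: P_eq_0_iff Q_def zero_power)
qed

lemma Q_over:
  assumes "w \<noteq> 0"
  shows "(1 + 1 / w) ^ n - 1 = Q w / w ^ n"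
proof -
  have "1 + 1 / w = (w + 1) / w" using assms by (simp add: field_simps)
  then show ?thesis using assms by (simp add: Q_def power_divide diff_divide_distrib)
qed

lemma P_over:
  assumes "w \<noteq> 0"
  shows "complex_of_real a * (1 + 1 / w) ^ (n - 1) = P w / w ^ n"
proof -
  have "1 + 1 / w = (w + 1) / w" using assms by (simp add: field_simps)
  moreover have "w ^ n = w * w ^ (n - 1)" by (simp only: power_n)
  ultimately show ?thesis using assms by (simp add: P_def power_divide)
qed

lemma W_eq: "W = mobius_chart -` X"
proof -
  have "w \<in> W \<longleftrightarrow> mobius_chart w \<in> X" for w
  proof (cases "w = 0")
    case True
    then show ?thesis by (simp add: W_def X_def)
  next
    case False
    have "mobius_chart w \<in> X \<longleftrightarrow> norm (complex_of_real a * (1 + 1 / w) ^ (n - 1)) < norm ((1 + 1 / w) ^ n - 1)"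
      using False a0 by (auto simp: X_def U_def mobius_chart_def norm_mult norm_power)
    also have "\<dots> \<longleftrightarrow> w \<in> W"
      unfolding P_over[OF False] Q_over[OF False] W_def
      using False by (simp add: norm_divide divide_less_cancel)
    finally show ?thesis by simp
  qed
  then show ?thesis by auto
qed

lemma continuous_P: "continuous_on S P" and continuous_Q: "continuous_on S Q"
  unfolding P_def Q_def by (intro continuous_intros)+

lemma holomorphic_P: "P holomorphic_on S" and holomorphic_Q: "Q holomorphic_on S"
  unfolding P_def Q_def by (intro holomorphic_intros)+

lemma open_W: "open W"
  unfolding W_def by (intro open_Collect_less continuous_intros continuous_P continuous_Q)

lemma zero_in_W: "0 \<in> W"
  by (simp add: W_def)

text \<open>Large \<open>w\<close> correspond to points near the root of unity 1, an interior point
  of the complement of \<open>U\<close>. This is the reason for the shift by 1 in the chart.\<close>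

lemma bounded_W: "bounded W"
proof -
  have "open {z::complex. norm (z ^ n - 1) < a * norm z ^ (n - 1)}"
    by (intro open_Collect_less continuous_intros)
  moreover have "1 \<in> {z::complex. norm (z ^ n - 1) < a * norm z ^ (n - 1)}"
    using a0 by simp
  ultimately obtain e where e: "e > 0" "\<And>z::complex. dist z 1 < e \<Longrightarrow> norm (z ^ n - 1) < a * norm z ^ (n - 1)"
    unfolding open_dist by blast
  have "norm w \<le> 1 / e" if "w \<in> W" for w
  proof (rule ccontr)
    assume w: "\<not> norm w \<le> 1 / e"
    then have w0: "w \<noteq> 0" using e(1) by auto
    have "dist (1 + 1 / w) 1 < e"
      using w w0 e(1) by (simp add: dist_norm norm_divide field_simps)
    from e(2)[OF this] have "1 + 1 / w \<notin> U" by (simp add: U_def)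
    then show False
      using that w0 by (auto simp: W_eq X_def mobius_chart_def)
  qed
  then show ?thesis by (auto simp: bounded_iff)
qed

lemma range_mobius_chart_W: "mobius_chart ` W = X"
proof -
  have "x \<in> mobius_chart ` W" if "x \<in> X" for x
  proof (cases x)
    case None
    then show ?thesis using zero_in_W by (intro image_eqI[of _ _ 0]) simp_all
  next
    case (Some z)
    then have "z \<noteq> 1" using that root_notin_U[of 1] by (auto simp: X_def)
    then have "mobius_chart (1 / (z - 1)) = x"
      using Some by (simp add: mobius_chart_def)
    then show ?thesis using that unfolding W_eq by blast
  qed
  then show ?thesis by (auto simp: W_eq)
qed

text \<open>Without 0, \<open>W\<close> is a continuous image of \<open>U\<close>; the point 0 is a
  limit point because \<open>W\<close> is open.\<close>

lemma connected_W: "connected W"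
proof (rule connected_intermediate_closure)
  have "W - {0} = (\<lambda>z. 1 / (z - 1)) ` U"
  proof (intro equalityI subsetI)
    fix w assume w: "w \<in> W - {0}"
    then have "1 + 1 / w \<in> U" by (auto simp: W_eq X_def mobius_chart_def)
    then show "w \<in> (\<lambda>z. 1 / (z - 1)) ` U"
      using w by (intro image_eqI[of _ _ "1 + 1 / w"]) auto
  next
    fix w assume "w \<in> (\<lambda>z. 1 / (z - 1)) ` U"
    then obtain z where z: "z \<in> U" "w = 1 / (z - 1)" by auto
    then have "z \<noteq> 1" using root_notin_U[of 1] by auto
    then show "w \<in> W - {0}"
      using z by (auto simp: W_eq X_def mobius_chart_def)
  qed
  moreover have "connected ((\<lambda>z. 1 / (z - 1)) ` U)"
    using root_notin_U[of 1]
    by (intro connected_continuous_image connected_U continuous_intros) auto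
  ultimately show "connected (W - {0})" by simp
  show "W - {0} \<subseteq> W" by auto
  have "0 \<in> closure (W - {0})"
    using interior_limit_point[of 0 W] zero_in_W open_W by (simp add: interior_open islimpt_in_closure)
  then show "W \<subseteq> closure (W - {0})"
    using closure_subset[of "W - {0}"] by auto
qed

text \<open>The sublevel set |P| < r |Q| has its closure inside \<open>W\<close>, so
  \<open>f\<close> is continuous up to its frontier, and the frontier lies on the level set where
  \<open>bd\<close> applies.\<close>

lemma maximum_principle_level:
  assumes f: "f holomorphic_on W" and r: "0 < r" "r < 1"
    and bd: "\<And>w. norm (P w) = r * norm (Q w) \<Longrightarrow> norm (f w) \<le> B"
    and w: "norm (P w) \<le> r * norm (Q w)"
  shows "norm (f w) \<le> B"
proof -
  define S where "S = {w. norm (P w) < r * norm (Q w)}"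
  have T: "closed {w. norm (P w) \<le> r * norm (Q w)}"
    by (intro closed_Collect_le continuous_intros continuous_P continuous_Q)
  have S: "open S"
    unfolding S_def by (intro open_Collect_less continuous_intros continuous_P continuous_Q)
  have cl: "closure S \<subseteq> {w. norm (P w) \<le> r * norm (Q w)}"
    by (rule closure_minimal[OF _ T]) (auto simp: S_def)
  have "{w. norm (P w) \<le> r * norm (Q w)} \<subseteq> W"
  proof clarify
    fix w assume *: "norm (P w) \<le> r * norm (Q w)"
    also have le: "\<dots> \<le> 1 * norm (Q w)" using r by (intro mult_right_mono) auto
    finally have "Q w \<noteq> 0" by (intro Q_nonzero) simp
    then have "r * norm (Q w) < norm (Q w)" using r by simp
    with * show "w \<in> W" by (simp add: W_def)
  qed
  with cl have clW: "closure S \<subseteq> W" by auto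
  show ?thesis
  proof (cases "w \<in> S")
    case True
    show ?thesis
    proof (rule maximum_modulus_frontier[of f S])
      show "f holomorphic_on interior S"
        using f clW by (meson closure_subset holomorphic_on_subset interior_subset order_trans)
      show "continuous_on (closure S) f"
        using f clW by (meson holomorphic_on_imp_continuous_on holomorphic_on_subset)
      show "bounded S"
        using clW bounded_W closure_subset by (metis bounded_subset)
      fix z assume "z \<in> frontier S"
      then have "z \<in> closure S" "z \<notin> S" using S by (auto simp: frontier_def interior_open)
      then show "norm (f z) \<le> B"
        using cl by (intro bd) (auto simp: S_def)
    qed fact
  next
    case False
    then show ?thesis using w by (intro bd) (auto simp: S_def)
  qed
qed

text \<open>As \<open>r\<close> increases to 1, the level sets of |P / Q| exhaust \<open>W\<close>,
  and the limit of \<open>g\<close> takes the place of boundary values. Only levels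
  \<open>r > 0\<close> occur, which permits the choice \<open>1 / r\<close> for
  \<open>g\<close>.\<close>

lemma maximum_principle:
  assumes f: "f holomorphic_on W"
    and g: "\<And>w. w \<in> W \<Longrightarrow> P w \<noteq> 0 \<Longrightarrow> norm (f w) \<le> g (norm (P w / Q w))"
    and lim: "(g \<longlongrightarrow> B) (at_left 1)" and w: "w \<in> W"
  shows "norm (f w) \<le> B"
proof (rule tendsto_lowerbound[OF lim])
  have Qw: "Q w \<noteq> 0" using w by (intro Q_nonzero) (simp add: W_def)
  define s where "s = norm (P w / Q w)"
  have s: "0 \<le> s" "s < 1" using w Qw by (simp_all add: s_def W_def norm_divide)
  show "\<forall>\<^sub>F r in at_left 1. norm (f w) \<le> g r"
    unfolding eventually_at_left_field
  proof (intro exI[of _ s] conjI allI impI)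
    fix r assume r: "s < r" "r < 1"
    show "norm (f w) \<le> g r"
    proof (rule maximum_principle_level[OF f, of r])
      show "0 < r" "r < 1" using r s by auto
      show "norm (P w) \<le> r * norm (Q w)"
        using r(1) Qw by (simp add: s_def norm_divide divide_less_eq)
      fix v assume v: "norm (P v) = r * norm (Q v)"
      have "r * norm (Q v) \<le> norm (Q v)" using r s by (intro mult_left_le_one_le) auto
      with v have Qv: "Q v \<noteq> 0" by (intro Q_nonzero) simp
      then have "r * norm (Q v) < norm (Q v)" using r by simp
      then have "v \<in> W" using v by (simp add: W_def)
      moreover have "P v \<noteq> 0" using v Qv r s by auto
      moreover have "norm (P v / Q v) = r" using v Qv by (simp add: norm_divide)
      ultimately show "norm (f v) \<le> g r" using g[of v] by simp
    qed
  qed (use s in auto)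
qed simp

end

subsection \<open>Symmetrization, extremality and uniqueness\<close>

definition rotate_sphere :: "complex \<Rightarrow> riemann_sphere \<Rightarrow> riemann_sphere" where
  "rotate_sphere c = map_option ((*) c)"

lemma rotate_sphere_chart_inf:
  assumes "c \<noteq> 0"
  shows "rotate_sphere c (chart_inf w) = chart_inf (w / c)"
  using assms by (simp add: rotate_sphere_def chart_inf_def)

lemma sphere_holomorphic_rotate:
  assumes "sphere_holomorphic_on f X" "c \<noteq> 0" "rotate_sphere c ` X \<subseteq> X"
  shows "sphere_holomorphic_on (f \<circ> rotate_sphere c) X"
  unfolding sphere_holomorphic_on_def
proof
  have f: "(f \<circ> Some) holomorphic_on (Some -` X)" "(f \<circ> chart_inf) holomorphic_on (chart_inf -` X)"
    using assms by (auto simp: sphere_holomorphic_on_def)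
  have "((f \<circ> Some) \<circ> (\<lambda>z. c * z)) holomorphic_on (Some -` X)"
    by (rule holomorphic_on_compose_gen[OF _ f(1)])
       (use assms(3) in \<open>auto intro!: holomorphic_intros simp: rotate_sphere_def image_subset_iff\<close>)
  then show "(f \<circ> rotate_sphere c \<circ> Some) holomorphic_on (Some -` X)"
    by (simp add: rotate_sphere_def o_def)
  have "((f \<circ> chart_inf) \<circ> (\<lambda>w. w / c)) holomorphic_on (chart_inf -` X)"
  proof (rule holomorphic_on_compose_gen[OF _ f(2)])
    show "(\<lambda>w. w / c) holomorphic_on (chart_inf -` X)"
      using assms(2) by (intro holomorphic_intros)
    show "(\<lambda>w. w / c) ` (chart_inf -` X) \<subseteq> chart_inf -` X"
      using assms(3) by (auto simp: rotate_sphere_chart_inf[OF assms(2), symmetric])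
  qed
  then show "(f \<circ> rotate_sphere c \<circ> chart_inf) holomorphic_on (chart_inf -` X)"
    by (simp add: rotate_sphere_chart_inf[OF assms(2)] o_def)
qed

text \<open>In the chart at infinity the rotation is division by \<open>c\<close>, so the chain rule
  yields a factor \<open>1 / c\<close> that the outer \<open>c\<close> cancels.\<close>

lemma rotate_deriv_chart_inf:
  assumes "((f \<circ> chart_inf) has_field_derivative d) (at 0)" "c \<noteq> 0"
  shows "((\<lambda>w. c * f (rotate_sphere c (chart_inf w))) has_field_derivative d) (at 0)"
proof -
  have "(((f \<circ> chart_inf) \<circ> (\<lambda>w. w / c)) has_field_derivative d * (1 / c)) (at 0)"
    by (rule DERIV_chain) (use assms in \<open>auto intro!: derivative_eq_intros\<close>)
  then have "((\<lambda>w. c * ((f \<circ> chart_inf) \<circ> (\<lambda>w. w / c)) w) has_field_derivative c * (d * (1 / c))) (at 0)"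
    by (rule DERIV_cmult)
  then show ?thesis
    using assms(2) by (simp add: rotate_sphere_chart_inf o_def)
qed

section \<open>Averaging over rotations\<close>

context small_parameter
begin

definition \<omega> :: complex where
  "\<omega> = cis (2 * pi / n)"

lemma omega_power_n: "\<omega> ^ n = 1"
  by (simp add: \<omega>_def Complex.DeMoivre)

lemma norm_omega [simp]: "norm \<omega> = 1" and omega_nonzero [simp]: "\<omega> \<noteq> 0"
  by (simp_all add: \<omega>_def)

lemma rotate_U:
  assumes "z \<in> U"
  shows "\<omega> ^ k * z \<in> U"
proof -
  have "(\<omega> ^ k) ^ n = 1"
    by (metis omega_power_n power_mult mult.commute power_one)
  then show ?thesis
    using assms by (simp add: U_def norm_mult norm_power power_mult_distrib)
qed

lemma rotate_X: "rotate_sphere (\<omega> ^ k) ` X \<subseteq> X"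
  using rotate_U by (auto simp: X_def rotate_sphere_def)

lemma vimage_Some_X: "Some -` X = U"
  by (auto simp: X_def)

text \<open>The weight \<open>\<omega> ^ k\<close> compensates for the effect of the rotation on the
  derivative at infinity.\<close>

definition average :: "(riemann_sphere \<Rightarrow> complex) \<Rightarrow> riemann_sphere \<Rightarrow> complex" where
  "average h x = (\<Sum>k<n. \<omega> ^ k * h (rotate_sphere (\<omega> ^ k) x)) / n"

lemma sphere_holomorphic_average:
  assumes "sphere_holomorphic_on h X"
  shows "sphere_holomorphic_on (average h) X"
proof -
  have *: "sphere_holomorphic_on (h \<circ> rotate_sphere (\<omega> ^ k)) X" for k
    by (rule sphere_holomorphic_rotate[OF assms _ rotate_X]) simp
  then show ?thesis
    unfolding sphere_holomorphic_on_def average_def o_def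
    by (intro conjI holomorphic_intros) auto
qed

lemma deriv_inf_average:
  assumes "sphere_holomorphic_on h X"
  shows "deriv_inf (average h) = deriv_inf h"
proof (rule deriv_inf_chart_inf)
  have "((h \<circ> chart_inf) has_field_derivative deriv_inf h) (at 0)"
    by (rule sphere_holomorphic_deriv_chart_inf[OF assms openin_X]) (simp add: X_def)
  then have "((\<lambda>w. \<Sum>k<n. \<omega> ^ k * h (rotate_sphere (\<omega> ^ k) (chart_inf w))) has_field_derivative
      (\<Sum>k<n. deriv_inf h)) (at 0)"
    by (intro DERIV_sum rotate_deriv_chart_inf) auto
  then have "((\<lambda>w. (\<Sum>k<n. \<omega> ^ k * h (rotate_sphere (\<omega> ^ k) (chart_inf w))) / n) has_field_derivative
      (\<Sum>k<n. deriv_inf h) / n) (at 0)"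
    by (rule DERIV_cdivide)
  then show "((average h \<circ> chart_inf) has_field_derivative deriv_inf h) (at 0)"
    by (simp add: average_def[abs_def] o_def)
qed

text \<open>Rotation shifts the summation index by one, and the term for \<open>k = n\<close> equals
  the term for \<open>k = 0\<close>.\<close>

lemma average_rotate: "\<omega> * average h (Some (\<omega> * z)) = average h (Some z)"
proof -
  let ?c = "\<lambda>k. \<omega> ^ k * h (Some (\<omega> ^ k * z))"
  have "\<omega> * (\<Sum>k<n. \<omega> ^ k * h (Some (\<omega> ^ k * (\<omega> * z)))) = (\<Sum>k<n. ?c (Suc k))"
    by (simp add: sum_distrib_left mult_ac)
  also have "\<dots> = (\<Sum>k<Suc n. ?c k) - ?c 0"
    by (simp only: sum.lessThan_Suc_shift) simp
  also have "\<dots> = (\<Sum>k<n. ?c k)"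
    by (simp add: omega_power_n)
  finally show ?thesis
    by (simp add: average_def rotate_sphere_def)
qed

lemma average_None:
  assumes "h None = 0"
  shows "average h None = 0"
  using assms by (simp add: average_def rotate_sphere_def)

lemma norm_rotated_le:
  assumes "h ` X \<subseteq> ball 0 1" "x \<in> X"
  shows "norm (\<omega> ^ k * h (rotate_sphere (\<omega> ^ k) x)) \<le> 1"
proof -
  have "rotate_sphere (\<omega> ^ k) x \<in> X" using rotate_X assms(2) by blast
  then have "h (rotate_sphere (\<omega> ^ k) x) \<in> ball 0 1" using assms(1) by blast
  then show ?thesis by (simp add: norm_mult norm_power)
qed

lemma norm_average_le:
  assumes h: "h ` X \<subseteq> ball 0 1" and x: "x \<in> X"
  shows "norm (average h x) \<le> 1"
proof -
  have "norm (\<Sum>k<n. \<omega> ^ k * h (rotate_sphere (\<omega> ^ k) x)) \<le> of_nat (card {..<n}) * 1"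
    by (intro sum_norm_bound norm_rotated_le[OF h x])
  then show ?thesis
    by (simp add: average_def norm_divide divide_le_eq)
qed

section \<open>The map as a competitor, and division of averages by it\<close>

definition F :: "riemann_sphere \<Rightarrow> complex" where
  "F = the \<circ> R"

lemma F_None [simp]: "F None = 0"
  by (simp add: F_def R_None)

lemma F_Some:
  fixes z :: complex
  shows "z \<in> U \<Longrightarrow> F (Some z) = a * z ^ (n - 1) / (z ^ n - 1)"
  using root_notin_U by (auto simp: F_def R_Some)

lemma F_mobius_chart:
  assumes "w \<in> W"
  shows "F (mobius_chart w) = P w / Q w"
proof (cases "w = 0")
  case False
  then have "1 + 1 / w \<in> U"
    using assms by (auto simp: W_eq X_def mobius_chart_def)
  from F_Some[OF this] show ?thesis
    using False by (simp add: mobius_chart_def P_over[OF False, simplified] Q_over)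
qed simp

lemma F_chart_inf:
  fixes w :: complex
  assumes "chart_inf w \<in> X"
  shows "w ^ n \<noteq> 1" "F (chart_inf w) = a * w / (1 - w ^ n)"
proof -
  show ne: "w ^ n \<noteq> 1"
  proof
    assume *: "w ^ n = 1"
    then have "w \<noteq> 0" by (auto simp: zero_power)
    then have "1 / w \<in> U" using assms by (simp add: chart_inf_def X_def image_iff)
    moreover have "(1 / w) ^ n = 1" using * by (simp add: power_one_over)
    ultimately show False using root_notin_U by blast
  qed
  show "F (chart_inf w) = a * w / (1 - w ^ n)"
  proof (cases "w = 0")
    case False
    then have "1 / w \<in> U" using assms by (simp add: chart_inf_def X_def image_iff)
    then have "F (chart_inf w) = a * (1 / w) ^ (n - 1) / ((1 / w) ^ n - 1)"
      using False by (simp add: chart_inf_def F_Some)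
    also have "\<dots> = (a * (1 / w) ^ (n - 1) * w ^ n) / (((1 / w) ^ n - 1) * w ^ n)"
      using False by simp
    also have "((1 / w) ^ n - 1) * w ^ n = 1 - w ^ n"
      using False by (simp add: power_one_over left_diff_distrib)
    also have "a * (1 / w) ^ (n - 1) * w ^ n = a * w"
      using False by (simp add: power_n[symmetric] power_one_over)
    finally show ?thesis .
  qed simp
qed

lemma admissible_F: "ahlfors_admissible X F"
proof -
  have "(\<lambda>z. a * z ^ (n - 1) / (z ^ n - 1)) holomorphic_on U"
    using root_notin_U by (intro holomorphic_intros) auto
  then have "(F \<circ> Some) holomorphic_on U"
    by (rule holomorphic_transform) (simp add: F_Some)
  moreover have "(\<lambda>w. a * w / (1 - w ^ n)) holomorphic_on (chart_inf -` X)"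
    using F_chart_inf(1) by (intro holomorphic_intros) force
  then have "(F \<circ> chart_inf) holomorphic_on (chart_inf -` X)"
    by (rule holomorphic_transform) (simp add: F_chart_inf)
  moreover have "F x \<in> ball 0 1" if "x \<in> X" for x
    using that unfolding vimage_R_disk[symmetric] by (auto simp: F_def unit_disk_def)
  ultimately show ?thesis
    by (auto simp: ahlfors_admissible_def sphere_holomorphic_on_def vimage_Some_X)
qed

lemma deriv_inf_F: "deriv_inf F = a"
proof (rule deriv_inf_chart_inf)
  obtain e where e: "e > 0" "ball 0 e \<subseteq> chart_inf -` X"
    using open_chart_inf_vimage[OF openin_X] by (auto simp: X_def)
  have "((\<lambda>w. a * w / (1 - w ^ n)) has_field_derivative complex_of_real a) (at 0)"
    by (auto intro!: derivative_eq_intros simp: zero_power)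
  then show "((F \<circ> chart_inf) has_field_derivative complex_of_real a) (at 0)"
    by (rule has_field_derivative_transform_within_open[of _ _ _ "ball 0 e"])
       (use e F_chart_inf in auto)
qed

text \<open>\<open>V\<close> is the average divided by \<open>F\<close>. The simple zero of
  \<open>P\<close> at \<open>w = 0\<close> cancels against the zero of the average at infinity; the
  zero of order \<open>n - 1\<close> at \<open>w = -1\<close>, that is at z = 0, cancels by
  symmetry. To first order at 0, \<open>P w / Q w\<close> is \<open>a * w\<close>, hence the formula
  for \<open>deriv_inf h\<close>.\<close>

lemma average_factor:
  assumes h: "ahlfors_admissible X h"
  obtains V where "V holomorphic_on W" "\<And>w. w \<in> W \<Longrightarrow> average h (mobius_chart w) = V w * (P w / Q w)"
    "deriv_inf h = V 0 * a"
proof -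
  define G where "G = average h \<circ> mobius_chart"
  have hol: "sphere_holomorphic_on h X" and h0: "h None = 0"
    using h by (auto simp: ahlfors_admissible_def)
  note av = sphere_holomorphic_average[OF hol]
  have G: "G holomorphic_on W"
    unfolding G_def W_eq using av open_W by (intro holomorphic_mobius_chart) (auto simp: W_eq)
  have G0: "G 0 = 0" by (simp add: G_def average_None h0)
  have dG: "(G has_field_derivative deriv_inf h) (at 0)"
    unfolding G_def using sphere_holomorphic_deriv_chart_inf[OF av openin_X]
    by (intro deriv_mobius_chart) (simp add: X_def deriv_inf_average[OF hol])
  define G1 where "G1 = (\<lambda>w. if w = 0 then deriv G 0 else (G w - G 0) / (w - 0))"
  have G1: "G1 holomorphic_on W"
    unfolding G1_def by (rule pole_lemma_open[OF G open_W])
  have G1_0: "G1 0 = deriv_inf h"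
    using DERIV_imp_deriv[OF dG] by (simp add: G1_def)
  \<comment> \<open>The law has exponent 1, and the powers of \<open>\<omega>\<close> from 1 to
    \<open>n - 1\<close> differ from 1, so \<open>n - 1\<close> factors split off.\<close>
  have "\<exists>H. H holomorphic_on U \<and> (\<forall>z\<in>U. (average h \<circ> Some) z = z ^ (n - 1) * H z)"
  proof (rule holomorphic_factor_of_rotation[OF open_U zero_in_U, where \<omega> = \<omega> and k = 1])
    show "(average h \<circ> Some) holomorphic_on U"
      using av by (simp add: sphere_holomorphic_on_def vimage_Some_X)
    show "\<omega> * z \<in> U" if "z \<in> U" for z
      using rotate_U[OF that, of 1] by simp
    show "\<omega> ^ 1 * (average h \<circ> Some) (\<omega> * z) = (average h \<circ> Some) z" for z
      using average_rotate by simp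
    show "\<omega> ^ j \<noteq> 1" if "1 \<le> j" "j < 1 + (n - 1)" for j
      unfolding \<omega>_def by (rule primitive_root_power_neq_1) (use that n2 in auto)
  qed simp
  then obtain H where H: "H holomorphic_on U" "\<And>z. z \<in> U \<Longrightarrow> average h (Some z) = z ^ (n - 1) * H z"
    by auto
  \<comment> \<open>The value at -1 is that of \<open>H z * (z ^ n - 1) / a\<close> at
    \<open>z = 0\<close>; the other branch would divide by 0 there.\<close>
  define V where "V w = (if w = -1 then - H 0 / a else G1 w * Q w / (a * (w + 1) ^ (n - 1)))" for w :: complex
  have m1: "w + 1 \<noteq> 0" if "w \<noteq> -1" for w :: complex
    using that by (metis add_eq_0_iff2)
  have Qw: "Q w \<noteq> 0" if "w \<in> W" for w
    using that by (intro Q_nonzero) (simp add: W_def)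
  \<comment> \<open>This second formula is regular at \<open>w = -1\<close>, just as the defining
    one is at \<open>w = 0\<close>.\<close>
  have V_eq: "V w = H (1 + 1 / w) * ((1 + 1 / w) ^ n - 1) / a" if "w \<in> W - {0}" for w
  proof (cases "w = -1")
    case True
    then show ?thesis by (simp add: V_def zero_power)
  next
    case False
    have w: "w \<noteq> 0" "1 + 1 / w \<in> U" using that by (auto simp: W_eq X_def mobius_chart_def)
    have "G w = (1 + 1 / w) ^ (n - 1) * H (1 + 1 / w)"
      using w H(2)[OF w(2)] by (simp add: G_def mobius_chart_def)
    also have "(1 + 1 / w) ^ (n - 1) = P w / w ^ n / a"
      unfolding P_over[OF w(1), symmetric] using a0 by simp
    also have "P w / w ^ n / a = w * (w + 1) ^ (n - 1) / w ^ n"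
      using a0 by (simp add: P_def)
    finally have "G1 w = (w + 1) ^ (n - 1) / w ^ n * H (1 + 1 / w)"
      using w by (simp add: G1_def G0)
    then have "V w = (w + 1) ^ (n - 1) / w ^ n * H (1 + 1 / w) * Q w / (a * (w + 1) ^ (n - 1))"
      using False by (simp add: V_def)
    also have "\<dots> = H (1 + 1 / w) * (Q w / w ^ n) / a"
      using m1[OF False] by simp
    finally show ?thesis
      using w by (simp only: Q_over not_False_eq_True)
  qed
  have "(\<lambda>w. G1 w * Q w / (a * (w + 1) ^ (n - 1))) holomorphic_on (W - {-1})"
    using a0 m1 by (intro holomorphic_intros holomorphic_Q holomorphic_on_subset[OF G1]) auto
  then have 1: "V holomorphic_on (W - {-1})"
    by (rule holomorphic_transform) (auto simp: V_def)
  have "(H \<circ> (\<lambda>w. 1 + 1 / w)) holomorphic_on (W - {0})"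
    by (rule holomorphic_on_compose_gen[OF _ H(1)])
       (auto intro!: holomorphic_intros simp: W_eq X_def mobius_chart_def split: if_splits)
  then have "(\<lambda>w. H (1 + 1 / w)) holomorphic_on (W - {0})"
    by (simp add: o_def)
  then have "(\<lambda>w. H (1 + 1 / w) * ((1 + 1 / w) ^ n - 1) / a) holomorphic_on (W - {0})"
    using a0 by (intro holomorphic_intros) auto
  then have 2: "V holomorphic_on (W - {0})"
    by (rule holomorphic_transform) (simp add: V_eq)
  have "V holomorphic_on ((W - {0}) \<union> (W - {-1}))"
    using 1 2 open_W by (intro holomorphic_on_Un) (auto intro: open_delete)
  then have V: "V holomorphic_on W"
    by (rule holomorphic_on_subset) auto
  show thesis
  proof (rule that[OF V])
    show "deriv_inf h = V 0 * a"
      using a0 by (simp add: V_def G1_0)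
    fix w assume w: "w \<in> W"
    show "average h (mobius_chart w) = V w * (P w / Q w)"
    proof (cases "w = -1")
      case True
      have "average h (Some 0) = 0"
        using H(2)[OF zero_in_U] n2 by (simp add: zero_power)
      moreover have "P (-1) = 0" by (simp add: P_eq_0_iff)
      ultimately show ?thesis using True by (simp add: mobius_chart_def)
    next
      case False
      have "G w = w * G1 w" by (simp add: G1_def G0)
      then show ?thesis
        using False m1[OF False] Qw[OF w] a0 by (simp add: G_def V_def P_def)
    qed
  qed
qed

text \<open>The average is bounded by 1, so |V| is at most \<open>1 / r\<close> on the level |P / Q|
  = r, and \<open>1 / r\<close> tends to 1.\<close>

lemma norm_factor_le:
  assumes h: "h ` X \<subseteq> ball 0 1" and V: "V holomorphic_on W"
    and eq: "\<And>w. w \<in> W \<Longrightarrow> average h (mobius_chart w) = V w * (P w / Q w)"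
    and w: "w \<in> W"
  shows "norm (V w) \<le> 1"
proof (rule maximum_principle[OF V _ _ w, where g = "\<lambda>r. 1 / r"])
  fix w assume w: "w \<in> W" "P w \<noteq> 0"
  have "norm (V w) * norm (P w / Q w) \<le> 1"
    using norm_average_le[OF h, of "mobius_chart w"] w
    unfolding norm_mult[symmetric] eq[OF w(1), symmetric] by (simp add: W_eq)
  moreover have "norm (P w / Q w) > 0"
    using w Q_nonzero[of w] by (simp add: W_def)
  ultimately show "norm (V w) \<le> 1 / norm (P w / Q w)"
    by (simp only: pos_le_divide_eq)
next
  show "((\<lambda>r. 1 / r) \<longlongrightarrow> 1) (at_left (1::real))"
    by (auto intro!: tendsto_eq_intros)
qed

lemma Re_deriv_inf_le:
  assumes h: "ahlfors_admissible X h"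
  shows "Re (deriv_inf h) \<le> a"
proof -
  obtain V where V: "V holomorphic_on W" "\<And>w. w \<in> W \<Longrightarrow> average h (mobius_chart w) = V w * (P w / Q w)"
    "deriv_inf h = V 0 * a"
    using average_factor[OF h] by blast
  have "norm (V 0) \<le> 1"
    using h by (intro norm_factor_le[OF _ V(1,2) zero_in_W]) (auto simp: ahlfors_admissible_def)
  then have "Re (V 0) \<le> 1"
    using complex_Re_le_cmod order_trans by blast
  then show ?thesis
    unfolding V(3) using a0 by simp
qed

lemma maximizer_F: "ahlfors_maximizer X F"
  using admissible_F Re_deriv_inf_le by (simp add: ahlfors_maximizer_def deriv_inf_F)

text \<open>Maximality gives \<open>Re (V 0) \<ge> 1\<close>, while |V| is at most 1. So
  \<open>V 0 = 1\<close>, |V| attains its maximum at an interior point, and \<open>V\<close> is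
  constant.\<close>

lemma maximizer_average:
  assumes h: "ahlfors_maximizer X h" and x: "x \<in> X"
  shows "average h x = F x"
proof -
  have adm: "ahlfors_admissible X h" and h1: "h ` X \<subseteq> ball 0 1"
    using h by (auto simp: ahlfors_maximizer_def ahlfors_admissible_def)
  obtain V where V: "V holomorphic_on W" "\<And>w. w \<in> W \<Longrightarrow> average h (mobius_chart w) = V w * (P w / Q w)"
    "deriv_inf h = V 0 * a"
    using average_factor[OF adm] by blast
  have V1: "norm (V w) \<le> 1" if "w \<in> W" for w
    by (rule norm_factor_le[OF h1 V(1,2) that])
  have "a \<le> Re (deriv_inf h)"
    using h admissible_F deriv_inf_F unfolding ahlfors_maximizer_def by (metis Re_complex_of_real)
  then have re: "1 \<le> Re (V 0)"
    unfolding V(3) using a0 by simp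
  then have "1 \<le> norm (V 0)"
    using complex_Re_le_cmod order_trans by blast
  with V1[OF zero_in_W] have n1: "norm (V 0) = 1" by simp
  then have "(Re (V 0))\<^sup>2 + (Im (V 0))\<^sup>2 = 1"
    by (metis cmod_power2 power_one)
  moreover have "1 \<le> (Re (V 0))\<^sup>2" using re by simp
  ultimately have "Im (V 0) = 0" "(Re (V 0))\<^sup>2 = 1"
    by (smt (verit) zero_le_power2 power2_eq_iff zero_eq_power2)+
  then have V0: "V 0 = 1"
    using re by (simp add: complex_eq_iff power2_eq_1_iff)
  have "V constant_on W"
    by (rule maximum_modulus_principle[OF V(1) open_W connected_W open_W subset_refl zero_in_W])
       (use V1 n1 in simp)
  then have "V w = 1" if "w \<in> W" for w
    using that V0 zero_in_W unfolding constant_on_def by metis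
  moreover obtain w where "w \<in> W" "x = mobius_chart w"
    using x range_mobius_chart_W by auto
  ultimately show ?thesis
    using V(2) by (simp add: F_mobius_chart)
qed

text \<open>The rotated copies of \<open>h\<close> have mean \<open>F\<close>, so the variance bound
  makes \<open>h - F\<close> small wherever |F| is near 1. The maximum principle with limit 0 then
  makes the difference vanish.\<close>

lemma maximizer_unique:
  assumes h: "ahlfors_maximizer X h" and x: "x \<in> X"
  shows "h x = F x"
proof -
  have hol: "sphere_holomorphic_on h X" and h1: "h ` X \<subseteq> ball 0 1"
    using h by (auto simp: ahlfors_maximizer_def ahlfors_admissible_def)
  have bound: "(norm (h y - F y))\<^sup>2 \<le> n * (1 - (norm (F y))\<^sup>2)" if y: "y \<in> X" for y
  proof -
    let ?c = "\<lambda>k. \<omega> ^ k * h (rotate_sphere (\<omega> ^ k) y)"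
    have "norm (?c k) \<le> 1" for k
      by (rule norm_rotated_le[OF h1 y])
    moreover have "(\<Sum>k<n. ?c k) = of_nat n * F y"
      using maximizer_average[OF h y] by (simp add: average_def field_simps)
    \<comment> \<open>Index 0 is the unrotated \<open>h\<close>.\<close>
    ultimately have "(norm (?c 0 - F y))\<^sup>2 \<le> n * (1 - (norm (F y))\<^sup>2)"
      by (intro norm_average_bound) auto
    moreover have "rotate_sphere 1 y = y"
      by (cases y) (simp_all add: rotate_sphere_def)
    ultimately show ?thesis by simp
  qed
  obtain w where w: "w \<in> W" "x = mobius_chart w"
    using x range_mobius_chart_W by auto
  define D where "D v = h (mobius_chart v) - P v / Q v" for v
  have "(\<lambda>v. (h \<circ> mobius_chart) v - P v / Q v) holomorphic_on W"
    using Q_nonzero hol open_W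
    by (intro holomorphic_intros holomorphic_P holomorphic_Q holomorphic_mobius_chart[of h X, folded W_eq])
       (auto simp: W_def)
  then have D: "D holomorphic_on W"
    by (simp add: D_def[abs_def])
  have "norm (D w) \<le> 0"
  proof (rule maximum_principle[OF D _ _ w(1), where g = "\<lambda>r. sqrt (n * (1 - r\<^sup>2))"])
    fix v assume v: "v \<in> W"
    have "(norm (D v))\<^sup>2 \<le> n * (1 - (norm (P v / Q v))\<^sup>2)"
      using bound[of "mobius_chart v"] v by (simp add: D_def F_mobius_chart W_eq)
    then show "norm (D v) \<le> sqrt (n * (1 - (norm (P v / Q v))\<^sup>2))"
      by (rule real_le_rsqrt)
  next
    show "((\<lambda>r::real. sqrt (n * (1 - r\<^sup>2))) \<longlongrightarrow> 0) (at_left 1)"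
      by (auto intro!: tendsto_eq_intros)
  qed
  then show ?thesis
    using w by (simp add: D_def F_mobius_chart)
qed

lemma rational_ahlfors_function_R: "rational_ahlfors_function n R"
  unfolding rational_ahlfors_function_def is_ahlfors_function_def vimage_R_disk F_def[symmetric]
  using good_R sphere_domain_X maximizer_F maximizer_unique by (auto simp: X_def)

end

text \<open>The quotient of \<open>t ^ n + 1\<close> by \<open>t ^ (n - 1)\<close> is least at
  \<open>t = s\<close> with \<open>s ^ n = n - 1\<close>, where it equals
  \<open>n / s ^ (n - 1)\<close>, the upper limit for \<open>a\<close>.\<close>

lemma small_parameter_bound:
  fixes n :: nat and a t :: real
  assumes n: "n \<ge> 2" and a: "0 < a" "a < real n * (real n - 1) powr ((1 - real n) / real n)" and t: "0 \<le> t"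
  shows "a * t ^ (n - 1) < t ^ n + 1"
proof (cases "t = 0")
  case True
  then show ?thesis using n by (simp add: zero_power)
next
  case False
  define s where "s = (real n - 1) powr (1 / real n)"
  have s: "s > 0" using n by (simp add: s_def)
  have sn: "s ^ n = real n - 1"
    using n by (simp add: s_def powr_realpow[symmetric] powr_powr)
  have "(real n - 1) powr ((1 - real n) / real n) = s powr (- real (n - 1))"
    using n by (simp add: s_def powr_powr of_nat_diff)
  also have "\<dots> = 1 / s ^ (n - 1)"
    using s by (simp add: powr_minus powr_realpow divide_inverse)
  finally have a': "a * s ^ (n - 1) < n"
    using a s by (simp add: pos_less_divide_eq)
  \<comment> \<open>Multiplied by \<open>t ^ n\<close>, Bernoulli's inequality for
    \<open>s / t\<close> becomes \<open>n * s * t ^ (n - 1) \<le> (n - 1) * t ^ n + s ^ n\<close>,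
    whose right side is \<open>s ^ n * (t ^ n + 1)\<close>.\<close>
  have "1 + real n * (s / t - 1) \<le> (1 + (s / t - 1)) ^ n"
    by (rule Bernoulli_inequality) (use s t in simp)
  then have "(1 + real n * (s / t - 1)) * t ^ n \<le> (s / t) ^ n * t ^ n"
    using t by (intro mult_right_mono) auto
  also have "\<dots> = s ^ n" using False by (simp add: power_divide)
  also have "t ^ n = t * t ^ (n - 1)" using n by (metis One_nat_def Suc_pred less_le_trans pos2 power_Suc)
  finally have "(1 + real n * (s / t - 1)) * (t * t ^ (n - 1)) \<le> s ^ n" .
  moreover have "(1 + real n * (s / t - 1)) * (t * t ^ (n - 1)) =
      real n * s * t ^ (n - 1) - (real n - 1) * (t * t ^ (n - 1))"
    using False by (simp add: field_simps)
  ultimately have "real n * s * t ^ (n - 1) \<le> (real n - 1) * (t * t ^ (n - 1)) + s ^ n" by linarith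
  also have "t * t ^ (n - 1) = t ^ n" using n by (metis One_nat_def Suc_pred less_le_trans pos2 power_Suc)
  finally have "real n * (s * t ^ (n - 1)) \<le> s ^ n * (t ^ n + 1)"
    by (simp add: sn algebra_simps)
  moreover have "a * s ^ (n - 1) * (s * t ^ (n - 1)) < real n * (s * t ^ (n - 1))"
    using a' s t False by (intro mult_strict_right_mono) auto
  moreover have "a * s ^ (n - 1) * (s * t ^ (n - 1)) = s ^ n * (a * t ^ (n - 1))"
  proof -
    have "s * s ^ (n - 1) = s ^ n" using n by (metis One_nat_def Suc_pred less_le_trans pos2 power_Suc)
    then show ?thesis by (metis mult.assoc mult.commute)
  qed
  ultimately have "s ^ n * (a * t ^ (n - 1)) < s ^ n * (t ^ n + 1)" by linarith
  then show ?thesis using s by simp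
qed

theorem theorem4p1:
  fixes n :: nat and a :: real
  assumes "n \<ge> 2"
    and "0 < a"
    and "a < real n * (real n - 1) powr ((1 - real n) / real n)"
  shows "rational_ahlfors_function n
           (rational_fun (monom (complex_of_real a) (n - 1)) (monom 1 n - 1))"
proof -
  interpret small_parameter n a
    using assms small_parameter_bound by unfold_locales auto
  show ?thesis
    using rational_ahlfors_function_R unfolding R_def .
qed

end
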